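(* Let $n\ge1$ and let $W_0(t)=\sum_{w\in S_n}t^{\ell(w)}$ be the Poincaré polynomial of $S_n$. Then $$t^{-\frac12\ell(w_0)}W_0(t)=\mathrm{ev}^t_0(c^Y_{w_0})=\sum_{w\in S_n}w\,c^{X^{-1}}_{w_0}$$ and $$W_0(t)=\prod_{1\le i<j\le n}\frac{1-t^{j-i+1}}{1-t^{j-i}}=[n]!,\qquad\text{where}\quad[n]!=\prod_{d=1}^n\frac{1-t^d}{1-t}.$$
   Context: $t^{1/2}$ is an indeterminate over $\mathbb{C}$, $t=(t^{1/2})^2$; $\ell$ is the length function of $S_n$ and $w_0$ its longest element. In commuting variables $x_1,\ldots,x_n$ (on which $S_n$ acts by permutation) and $Y_1,\ldots,Y_n$, $$c^{X^{-1}}_{w_0}=\prod_{1\le i<j\le n}\frac{t^{-\frac12}-t^{\frac12}x_i^{-1}x_j}{1-x_i^{-1}x_j},\qquad c^Y_{w_0}=\prod_{1\le i<j\le n}\frac{t^{-\frac12}-t^{\frac12}Y_iY_j^{-1}}{1-Y_iY_j^{-1}},$$ and $\mathrm{ev}^t_0$ is the evaluation $Y_i\mapsto t^{-(i-1)+\frac12(n-1)}$. *)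

theory Defs
  imports
    Complex_Main
    "HOL-Library.Poly_Mapping"
    "HOL-Computational_Algebra.Polynomial"
    "HOL-Computational_Algebra.Fraction_Field"
    "HOL-Combinatorics.Permutations"
begin

section \<open>The coefficient field and rational functions in several variables\<close>

text \<open>
  The coefficient field is \<open>\<complex>(t\<^sup>1\<^sup>/\<^sup>2)\<close>; the polynomial variable is \<open>t\<^sup>1\<^sup>/\<^sup>2\<close>, not \<open>t\<close>.
  Polynomials over it have variables indexed by \<^typ>\<open>nat\<close>; for a given \<open>n\<close> only the
  variables with index in \<open>{1..n}\<close> are used.
\<close>

type_synonym coeff = "complex poly fract"
type_synonym mpol = "(nat \<Rightarrow>\<^sub>0 nat) \<Rightarrow>\<^sub>0 coeff"
type_synonym ratfun = "mpol fract"

definition t_half :: coeff where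
  "t_half = Fract [:0, 1:] 1"

definition t_var :: coeff where
  "t_var = t_half\<^sup>2"

definition rf_const :: "coeff \<Rightarrow> ratfun" where
  "rf_const c = Fract (Poly_Mapping.single 0 c) 1"

definition rf_var :: "nat \<Rightarrow> ratfun" where
  "rf_var i = Fract (Poly_Mapping.single (Poly_Mapping.single i 1) 1) 1"


section \<open>Substitution into polynomials and rational functions\<close>

definition monom_subst :: "(nat \<Rightarrow> 'b::field) \<Rightarrow> (nat \<Rightarrow>\<^sub>0 nat) \<Rightarrow> 'b" where
  "monom_subst y m = (\<Prod>i\<in>Poly_Mapping.keys m. y i ^ Poly_Mapping.lookup m i)"

definition mpol_subst :: "(coeff \<Rightarrow> 'b::field) \<Rightarrow> (nat \<Rightarrow> 'b) \<Rightarrow> mpol \<Rightarrow> 'b" where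
  "mpol_subst \<phi> y p =
     (\<Sum>m\<in>Poly_Mapping.keys p. \<phi> (Poly_Mapping.lookup p m) * monom_subst y m)"

text \<open>
  The value of a rational function at the point \<open>y\<close> is computed from any representation as
  a quotient whose denominator does not vanish at \<open>y\<close>. It is independent of the
  representation (lemma \<open>rf_subst_Fract\<close> below), and unspecified if there is none.
\<close>

definition rf_subst :: "(coeff \<Rightarrow> 'b::field) \<Rightarrow> (nat \<Rightarrow> 'b) \<Rightarrow> ratfun \<Rightarrow> 'b" where
  "rf_subst \<phi> y f =
     (THE v. \<exists>p q. f = Fract p q \<and> mpol_subst \<phi> y q \<noteq> 0 \<and>
                   v = mpol_subst \<phi> y p / mpol_subst \<phi> y q)"

lemma monom_subst_superset:
  assumes "finite A" "Poly_Mapping.keys m \<subseteq> A"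
  shows "monom_subst y m = (\<Prod>i\<in>A. y i ^ Poly_Mapping.lookup m i)"
  unfolding monom_subst_def
  by (rule prod.mono_neutral_left) (use assms in \<open>auto simp: in_keys_iff\<close>)

lemma monom_subst_add: "monom_subst y (m + m') = monom_subst y m * monom_subst y m'"
proof -
  let ?A = "Poly_Mapping.keys m \<union> Poly_Mapping.keys m'"
  have "monom_subst y (m + m') = (\<Prod>i\<in>?A. y i ^ Poly_Mapping.lookup (m + m') i)"
    by (rule monom_subst_superset) (auto simp: keys_add)
  also have "\<dots> = (\<Prod>i\<in>?A. y i ^ Poly_Mapping.lookup m i) *
                   (\<Prod>i\<in>?A. y i ^ Poly_Mapping.lookup m' i)"
    by (simp add: lookup_add power_add prod.distrib)
  also have "\<dots> = monom_subst y m * monom_subst y m'"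
    by (subst (1 2) monom_subst_superset[where A = ?A]) auto
  finally show ?thesis .
qed

locale coeff_hom =
  fixes \<phi> :: "coeff \<Rightarrow> 'b::field"
  assumes hom_zero: "\<phi> 0 = 0" and hom_one: "\<phi> 1 = 1"
    and hom_add: "\<phi> (a + b) = \<phi> a + \<phi> b" and hom_mult: "\<phi> (a * b) = \<phi> a * \<phi> b"
begin

lemma mpol_subst_superset:
  assumes "finite A" "Poly_Mapping.keys p \<subseteq> A"
  shows "mpol_subst \<phi> y p = (\<Sum>m\<in>A. \<phi> (Poly_Mapping.lookup p m) * monom_subst y m)"
  unfolding mpol_subst_def
  by (rule sum.mono_neutral_left) (use assms hom_zero in \<open>auto simp: in_keys_iff\<close>)

lemma mpol_subst_zero: "mpol_subst \<phi> y 0 = 0"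
  by (simp add: mpol_subst_def)

lemma mpol_subst_single:
  "mpol_subst \<phi> y (Poly_Mapping.single m c) = \<phi> c * monom_subst y m"
  by (subst mpol_subst_superset[where A = "{m}"]) auto

lemma mpol_subst_add: "mpol_subst \<phi> y (p + q) = mpol_subst \<phi> y p + mpol_subst \<phi> y q"
proof -
  let ?A = "Poly_Mapping.keys p \<union> Poly_Mapping.keys q"
  have "mpol_subst \<phi> y (p + q)
      = (\<Sum>m\<in>?A. \<phi> (Poly_Mapping.lookup (p + q) m) * monom_subst y m)"
    by (rule mpol_subst_superset) (auto simp: keys_add)
  also have "\<dots> = (\<Sum>m\<in>?A. \<phi> (Poly_Mapping.lookup p m) * monom_subst y m) +
                   (\<Sum>m\<in>?A. \<phi> (Poly_Mapping.lookup q m) * monom_subst y m)"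
    by (simp add: lookup_add hom_add algebra_simps sum.distrib)
  also have "\<dots> = mpol_subst \<phi> y p + mpol_subst \<phi> y q"
    by (subst (1 2) mpol_subst_superset[where A = ?A]) auto
  finally show ?thesis .
qed

lemma mpol_subst_sum: "mpol_subst \<phi> y (\<Sum>a\<in>A. g a) = (\<Sum>a\<in>A. mpol_subst \<phi> y (g a))"
  by (induction A rule: infinite_finite_induct) (simp_all add: mpol_subst_zero mpol_subst_add)

lemma mpol_sum_singles:
  fixes p :: mpol
  shows "p = (\<Sum>m\<in>Poly_Mapping.keys p. Poly_Mapping.single m (Poly_Mapping.lookup p m))"
proof (rule poly_mapping_eqI)
  fix k
  show "Poly_Mapping.lookup p k = Poly_Mapping.lookup
      (\<Sum>m\<in>Poly_Mapping.keys p. Poly_Mapping.single m (Poly_Mapping.lookup p m)) k"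
    by (simp add: lookup_sum lookup_single when_def in_keys_iff)
qed

lemma mpol_subst_mult: "mpol_subst \<phi> y (p * q) = mpol_subst \<phi> y p * mpol_subst \<phi> y q"
proof -
  let ?s = "\<lambda>p m. Poly_Mapping.single m (Poly_Mapping.lookup p m) :: mpol"
  have "p * q = (\<Sum>m\<in>Poly_Mapping.keys p. ?s p m) * (\<Sum>m'\<in>Poly_Mapping.keys q. ?s q m')"
    using mpol_sum_singles[of p] mpol_sum_singles[of q] by simp
  also have "\<dots> = (\<Sum>m\<in>Poly_Mapping.keys p. \<Sum>m'\<in>Poly_Mapping.keys q.
      Poly_Mapping.single (m + m') (Poly_Mapping.lookup p m * Poly_Mapping.lookup q m'))"
    by (simp add: sum_product mult_single)
  finally show ?thesis
    by (simp add: mpol_subst_sum mpol_subst_single hom_mult monom_subst_add)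
       (simp add: mpol_subst_def sum_product algebra_simps)
qed

lemma rf_subst_Fract:
  assumes "mpol_subst \<phi> y q \<noteq> 0"
  shows "rf_subst \<phi> y (Fract p q) = mpol_subst \<phi> y p / mpol_subst \<phi> y q"
  unfolding rf_subst_def
proof (rule the_equality)
  show "\<exists>p' q'. Fract p q = Fract p' q' \<and> mpol_subst \<phi> y q' \<noteq> 0 \<and>
      mpol_subst \<phi> y p / mpol_subst \<phi> y q = mpol_subst \<phi> y p' / mpol_subst \<phi> y q'"
    using assms by blast
next
  fix v
  assume "\<exists>p' q'. Fract p q = Fract p' q' \<and> mpol_subst \<phi> y q' \<noteq> 0 \<and>
      v = mpol_subst \<phi> y p' / mpol_subst \<phi> y q'"
  then obtain p' q' where eq: "Fract p q = Fract p' q'" and q': "mpol_subst \<phi> y q' \<noteq> 0"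
    and v: "v = mpol_subst \<phi> y p' / mpol_subst \<phi> y q'"
    by blast
  have "q \<noteq> 0" "q' \<noteq> 0"
    using assms q' by (auto simp: mpol_subst_zero)
  with eq have "p * q' = p' * q"
    by (simp add: eq_fract)
  then have "mpol_subst \<phi> y p * mpol_subst \<phi> y q' = mpol_subst \<phi> y p' * mpol_subst \<phi> y q"
    by (metis mpol_subst_mult)
  then show "v = mpol_subst \<phi> y p / mpol_subst \<phi> y q"
    using assms q' v by (simp add: frac_eq_eq)
qed

end

lemma coeff_hom_id: "coeff_hom (\<lambda>c. c)"
  by unfold_locales simp_all

lemma coeff_hom_rf_const: "coeff_hom rf_const"
proof
  show "rf_const 0 = 0" "rf_const 1 = 1"
    by (simp_all add: rf_const_def fract_collapse)
qed (simp_all add: rf_const_def single_add mult_single)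


section \<open>The symmetric group\<close>

text \<open>
  \<open>S\<^sub>n\<close> is \<open>{w. w permutes {1..n}}\<close>; the length is taken with respect to the
  simple transpositions \<open>s\<^sub>i = (i i+1)\<close>, \<open>1 \<le> i < n\<close>.
\<close>

definition simple_word :: "nat list \<Rightarrow> nat \<Rightarrow> nat" where
  "simple_word is = foldr (\<lambda>i v. transpose i (Suc i) \<circ> v) is id"

definition perm_length :: "nat \<Rightarrow> (nat \<Rightarrow> nat) \<Rightarrow> nat" where
  "perm_length n w =
     (LEAST k. \<exists>is. length is = k \<and> set is \<subseteq> {1..<n} \<and> simple_word is = w)"

definition longest_perm :: "nat \<Rightarrow> nat \<Rightarrow> nat" where
  "longest_perm n = (ARG_MAX (perm_length n) w. w permutes {1..n})"

definition poincare_poly :: "nat \<Rightarrow> 'a::comm_ring_1 \<Rightarrow> 'a" where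
  "poincare_poly n q = (\<Sum>w | w permutes {1..n}. q ^ perm_length n w)"

definition q_fact :: "nat \<Rightarrow> 'a::field \<Rightarrow> 'a" where
  "q_fact n q = (\<Prod>d=1..n. (1 - q ^ d) / (1 - q))"

text \<open>The action of \<open>S\<^sub>n\<close> on rational functions is the one with \<open>w x\<^sub>i = x\<^bsub>w(i)\<^esub>\<close>.\<close>

definition perm_act :: "(nat \<Rightarrow> nat) \<Rightarrow> ratfun \<Rightarrow> ratfun" where
  "perm_act w f = rf_subst rf_const (\<lambda>i. rf_var (w i)) f"


section \<open>The c-functions and the evaluation\<close>

definition c_Xinv :: "nat \<Rightarrow> ratfun" where
  "c_Xinv n = (\<Prod>(i, j) \<in> {(i, j). 1 \<le> i \<and> i < j \<and> j \<le> n}.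
     (rf_const (inverse t_half) - rf_const t_half * inverse (rf_var i) * rf_var j) /
     (1 - inverse (rf_var i) * rf_var j))"

text \<open>The variables \<open>Y\<^sub>i\<close> generate a second copy of the same field of rational functions.\<close>

definition c_Y :: "nat \<Rightarrow> ratfun" where
  "c_Y n = (\<Prod>(i, j) \<in> {(i, j). 1 \<le> i \<and> i < j \<and> j \<le> n}.
     (rf_const (inverse t_half) - rf_const t_half * rf_var i * inverse (rf_var j)) /
     (1 - rf_var i * inverse (rf_var j)))"

text \<open>
  \<open>Y\<^sub>i \<mapsto> t\<^bsup>-(i-1)+(n-1)/2\<^esup>\<close>, written as a power of \<open>t\<^sup>1\<^sup>/\<^sup>2\<close>.
\<close>

definition ev_t0 :: "nat \<Rightarrow> ratfun \<Rightarrow> coeff" where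
  "ev_t0 n f = rf_subst (\<lambda>c. c) (\<lambda>i. t_half powi (- 2 * (int i - 1) + (int n - 1))) f"

end

theory Submission
  imports Defs
begin

text \<open>
  For a two-variable weight \<open>g\<close> whose one-step sums \<open>\<Sum>b\<in>B. \<Prod>c\<in>B - {b}. g c b\<close> depend only on
  \<open>d = card B\<close>, the sum over \<open>S\<^sub>n\<close> of the products of \<open>g (x\<^bsub>w(i)\<^esub>) (x\<^bsub>w(j)\<^esub>)\<close> over \<open>i < j\<close> is the
  product of these one-step sums for \<open>d = 1, \<dots>, n\<close>. Both expressions for \<open>[n]!\<close> are instances:
  for the Poincare polynomial, \<open>g\<close> is \<open>t\<close> on an inversion and \<open>1\<close> otherwise; for the sum of the
  \<open>w c\<close>, up to a power of \<open>t\<^sup>1\<^sup>/\<^sup>2\<close>, \<open>g c b = (c - t b) / (c - b)\<close>, whose one-step sum is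
  \<open>(1 - t\<^sup>d) / (1 - t)\<close> by Lagrange interpolation. The evaluation at \<open>Y\<^sub>i Y\<^sub>j\<inverse> = t\<^bsup>j-i\<^esup>\<close> telescopes.
\<close>

section \<open>Symmetrised products over pairs of indices\<close>

definition index_pairs :: "nat \<Rightarrow> (nat \<times> nat) set" where
  "index_pairs n = {(i, j). 1 \<le> i \<and> i < j \<and> j \<le> n}"

lemma finite_index_pairs [simp]: "finite (index_pairs n)"
  by (rule finite_subset[of _ "{1..n} \<times> {1..n}"]) (auto simp: index_pairs_def)

lemma index_pairs_0 [simp]: "index_pairs 0 = {}"
  by (auto simp: index_pairs_def)

lemma prod_index_pairs_Suc:
  fixes f :: "nat \<times> nat \<Rightarrow> 'a::comm_monoid_mult"
  shows "prod f (index_pairs (Suc n)) = prod f (index_pairs n) * (\<Prod>i=1..n. f (i, Suc n))"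
proof -
  have eq: "index_pairs (Suc n) = index_pairs n \<union> (\<lambda>i. (i, Suc n)) ` {1..n}"
    by (auto simp: index_pairs_def)
  have "prod f (index_pairs (Suc n)) =
      prod f (index_pairs n) * prod f ((\<lambda>i. (i, Suc n)) ` {1..n})"
    unfolding eq by (rule prod.union_disjoint[OF finite_index_pairs]) (auto simp: index_pairs_def)
  also have "prod f ((\<lambda>i. (i, Suc n)) ` {1..n}) = (\<Prod>i=1..n. f (i, Suc n))"
    by (subst prod.reindex) (auto simp: inj_on_def)
  finally show ?thesis .
qed

text \<open>
  The induction splits the sum over \<open>S\<^sub>n\<^sub>+\<^sub>1\<close> according to \<open>w (n + 1)\<close>. It goes through because
  the sum over \<open>S\<^sub>n\<close> is the same for all tuples of distinct values.
\<close>

lemma sum_permutes_prod_pairs: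
  fixes g :: "'b \<Rightarrow> 'b \<Rightarrow> 'a::comm_semiring_1"
  assumes step: "\<And>B. finite B \<Longrightarrow> B \<subseteq> X \<Longrightarrow> (\<Sum>b\<in>B. \<Prod>c\<in>B - {b}. g c b) = s (card B)"
    and "inj_on x {1..n}" "x ` {1..n} \<subseteq> X"
  shows "(\<Sum>w | w permutes {1..n}. \<Prod>(i, j)\<in>index_pairs n. g (x (w i)) (x (w j))) =
    (\<Prod>d=1..n. s d)"
  using assms(2,3)
proof (induction n arbitrary: x)
  case 0
  then show ?case by simp
next
  case (Suc n)
  let ?S = "insert (Suc n) {1..n}"
  let ?B = "x ` {1..Suc n}"
  have S: "{1..Suc n} = ?S" by auto
  \<comment> \<open>The permutations sending \<open>Suc n\<close> to \<open>b\<close> are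
    \<open>transpose (Suc n) b\<close> composed with some \<open>q\<close> fixing
    \<open>Suc n\<close>. The pairs \<open>(i, Suc n)\<close> give the one-step product at
    \<open>x b\<close>; the other pairs give the sum over \<open>S_n\<close> for the remaining
    values.\<close>
  have inner: "(\<Sum>q | q permutes {1..n}. \<Prod>(i, j)\<in>index_pairs (Suc n).
        g (x ((transpose (Suc n) b \<circ> q) i)) (x ((transpose (Suc n) b \<circ> q) j))) =
      (\<Prod>d=1..n. s d) * (\<Prod>c\<in>?B - {x b}. g c (x b))" if b: "b \<in> ?S" for b
  proof -
    \<comment> \<open>\<open>y\<close> indexes the values of \<open>x\<close> other than
      \<open>x b\<close> by \<open>{1..n}\<close>; the induction hypothesis is applied to
      it.\<close>
    define y where "y = x \<circ> transpose (Suc n) b"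
    have im: "transpose (Suc n) b ` {1..n} = {1..Suc n} - {b}"
    proof -
      have "transpose (Suc n) b ` {1..n} = transpose (Suc n) b ` ({1..Suc n} - {Suc n})"
        by (rule arg_cong[where f = "image _"]) auto
      also have "\<dots> = transpose (Suc n) b ` {1..Suc n} - transpose (Suc n) b ` {Suc n}"
        by (rule image_set_diff) simp
      also have "transpose (Suc n) b ` {1..Suc n} = {1..Suc n}"
        using b by (intro permutes_image permutes_swap_id) auto
      finally show ?thesis by simp
    qed
    have inj_y: "inj_on y {1..n}"
      unfolding y_def using Suc.prems(1)
      by (rule comp_inj_on[OF inj_on_transpose inj_on_subset]) (auto simp only: im)
    have y_im: "y ` {1..n} = ?B - {x b}"
    proof -
      have "y ` {1..n} = x ` ({1..Suc n} - {b})"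
        unfolding y_def by (simp only: image_comp[symmetric] im)
      also have "\<dots> = ?B - x ` {b}"
        using b S by (intro inj_on_image_set_diff[OF Suc.prems(1)]) auto
      finally show ?thesis by simp
    qed
    \<comment> \<open>The product runs over all remaining values, so their order, and with it
      \<open>q\<close>, drops out.\<close>
    have last: "(\<Prod>i=1..n. g (y (q i)) (x b)) = (\<Prod>c\<in>?B - {x b}. g c (x b))"
      if q: "q permutes {1..n}" for q
    proof -
      have "(\<Prod>i=1..n. g (y (q i)) (x b)) = (\<Prod>i=1..n. g (y i) (x b))"
        using prod.permute[OF q, of "\<lambda>i. g (y i) (x b)"] by (simp add: o_def)
      also have "\<dots> = (\<Prod>c\<in>y ` {1..n}. g c (x b))"
        using inj_y by (simp add: prod.reindex)
      finally show ?thesis by (simp only: y_im)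
    qed
    have "(\<Sum>q | q permutes {1..n}. \<Prod>(i, j)\<in>index_pairs (Suc n).
        g (x ((transpose (Suc n) b \<circ> q) i)) (x ((transpose (Suc n) b \<circ> q) j))) =
      (\<Sum>q | q permutes {1..n}. (\<Prod>(i, j)\<in>index_pairs n. g (y (q i)) (y (q j))) *
        (\<Prod>c\<in>?B - {x b}. g c (x b)))"
    proof (rule sum.cong)
      fix q assume "q \<in> {q. q permutes {1..n}}"
      then have q: "q permutes {1..n}" by simp
      have "q (Suc n) = Suc n" using q by (auto simp: permutes_def)
      then show "(\<Prod>(i, j)\<in>index_pairs (Suc n).
          g (x ((transpose (Suc n) b \<circ> q) i)) (x ((transpose (Suc n) b \<circ> q) j))) =
          (\<Prod>(i, j)\<in>index_pairs n. g (y (q i)) (y (q j))) * (\<Prod>c\<in>?B - {x b}. g c (x b))"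
        using last[OF q] by (simp add: prod_index_pairs_Suc y_def)
    qed simp
    also have "\<dots> = (\<Sum>q | q permutes {1..n}. \<Prod>(i, j)\<in>index_pairs n. g (y (q i)) (y (q j))) *
        (\<Prod>c\<in>?B - {x b}. g c (x b))"
      by (simp add: sum_distrib_right)
    also have "(\<Sum>q | q permutes {1..n}. \<Prod>(i, j)\<in>index_pairs n. g (y (q i)) (y (q j))) =
        (\<Prod>d=1..n. s d)"
      using Suc.prems(2) y_im by (intro Suc.IH[OF inj_y]) auto
    finally show ?thesis .
  qed
  have "(\<Sum>w | w permutes {1..Suc n}. \<Prod>(i, j)\<in>index_pairs (Suc n). g (x (w i)) (x (w j))) =
      (\<Sum>b\<in>?S. (\<Prod>d=1..n. s d) * (\<Prod>c\<in>?B - {x b}. g c (x b)))"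
    unfolding S
    by (rule trans[OF sum_over_permutations_insert sum.cong[OF refl inner[unfolded S]]]) simp_all
  also have "\<dots> = (\<Prod>d=1..n. s d) * (\<Sum>b\<in>{1..Suc n}. \<Prod>c\<in>?B - {x b}. g c (x b))"
    by (simp only: S sum_distrib_left)
  also have "(\<Sum>b\<in>{1..Suc n}. \<Prod>c\<in>?B - {x b}. g c (x b)) = (\<Sum>b\<in>?B. \<Prod>c\<in>?B - {b}. g c b)"
    by (simp only: sum.reindex[OF Suc.prems(1)] o_def)
  also have "\<dots> = s (Suc n)"
    using Suc.prems step[of ?B] by (simp add: card_image)
  finally show ?case by simp
qed

section \<open>One-step sums of the two weights\<close>

lemma sum_prod_order_weight:
  fixes q :: "'a::comm_semiring_1" and B :: "'b::linorder set"
  assumes "finite B"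
  shows "(\<Sum>b\<in>B. \<Prod>c\<in>B - {b}. if b < c then q else 1) = (\<Sum>k<card B. q ^ k)"
  using assms
proof (induction B rule: finite_linorder_min_induct)
  case empty
  then show ?case by simp
next
  case (insert b A)
  have "b \<notin> A" using insert by auto
  \<comment> \<open>The new \<open>b\<close> lies below all of \<open>A\<close>: it contributes 1 to
    the product of each \<open>a\<close> in \<open>A\<close>, and its own product is the next power
    \<open>q ^ card A\<close>.\<close>
  have "(\<Prod>c\<in>insert b A - {a}. if a < c then q else 1) = (\<Prod>c\<in>A - {a}. if a < c then q else 1)"
    if "a \<in> A" for a
  proof -
    have "insert b A - {a} = insert b (A - {a})" using that \<open>b \<notin> A\<close> by auto
    moreover have "\<not> a < b" using insert that by auto
    ultimately show ?thesis using insert \<open>b \<notin> A\<close> by simp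
  qed
  moreover have "(\<Prod>c\<in>insert b A - {b}. if b < c then q else 1) = q ^ card A"
  proof -
    have "insert b A - {b} = A" using \<open>b \<notin> A\<close> by auto
    then show ?thesis using insert by simp
  qed
  ultimately show ?case
    using insert \<open>b \<notin> A\<close> by (simp add: add.commute)
qed

text \<open>The coefficient in degree \<open>card B\<close> replaces the leading coefficient because
  \<open>s\<close> may be 0. The interpolation below takes \<open>s = t\<close> and
  \<open>s = 1\<close>.\<close>

lemma degree_coeff_prod_linear:
  fixes s :: "'a::comm_ring_1"
  assumes "finite B"
  shows "degree (\<Prod>b\<in>B. [:- b, s:]) \<le> card B \<and> coeff (\<Prod>b\<in>B. [:- b, s:]) (card B) = s ^ card B"
  using assms
proof (induction B)
  case empty
  then show ?case by simp
next
  case (insert b B)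
  let ?p = "\<Prod>b\<in>B. [:- b, s:]"
  have "degree ([:- b, s:] * ?p) \<le> 1 + card B"
    by (rule order_trans[OF degree_mult_le add_mono]) (use insert in auto)
  moreover have "coeff ?p (Suc (card B)) = 0"
    using insert by (intro coeff_eq_0) auto
  ultimately show ?case
    using insert by simp
qed

text \<open>
  Both sides of the polynomial identity in the proof have degree at most \<open>card B\<close>, the same
  coefficient in that degree and the same values on \<open>B\<close>. The claim is its value at \<open>0\<close>.
\<close>

lemma sum_prod_rational_weight:
  fixes t :: "'a::field"
  assumes "finite B" "0 \<notin> B" "t \<noteq> 1"
  shows "(\<Sum>b\<in>B. \<Prod>c\<in>B - {b}. (c - t * b) / (c - b)) = (1 - t ^ card B) / (1 - t)"
proof -
  define A where "A b = (\<Prod>c\<in>B - {b}. (c - t * b) / (c - b))" for b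
  define f where "f = (\<Prod>b\<in>B. [:- b, t:])"
  \<comment> \<open>Lagrange interpolation: \<open>h\<close> agrees with \<open>f\<close> on
    \<open>B\<close>, where the other term of \<open>g\<close> vanishes. The scalar
    \<open>(t - 1) * b\<close> is the factor \<open>t * b - c\<close> of \<open>poly f b\<close> at
    \<open>c = b\<close>.\<close>
  define h where "h = (\<Sum>b\<in>B. smult ((t - 1) * b * A b) (\<Prod>c\<in>B - {b}. [:- c, 1:]))"
  define g where "g = smult (t ^ card B) (\<Prod>b\<in>B. [:- b, 1:]) + h"
  have deg_h: "degree (smult k (\<Prod>c\<in>B - {b}. [:- c, 1:])) < card B" if "b \<in> B" for b k
  proof -
    have "degree (\<Prod>c\<in>B - {b}. [:- c, 1:]) \<le> card (B - {b})"
      using degree_coeff_prod_linear[of "B - {b}" 1] assms(1) by simp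
    also have "\<dots> < card B" using that assms(1) by (rule card_Diff1_less[rotated])
    finally show ?thesis using degree_smult_le order.strict_trans1 by blast
  qed
  have "f = g"
  proof (rule poly_eqI_degree_lead_coeff[where A = B and n = "card B"])
    show "degree f \<le> card B"
      using degree_coeff_prod_linear[OF assms(1), of t] by (simp add: f_def)
    have "degree h \<le> card B"
      unfolding h_def by (intro degree_sum_le assms(1) less_imp_le[OF deg_h])
    then show "degree g \<le> card B"
      unfolding g_def using degree_coeff_prod_linear[OF assms(1), of 1]
      by (intro degree_add_le) (auto intro: order_trans[OF degree_smult_le])
    have "coeff h (card B) = 0"
      unfolding h_def coeff_sum by (intro sum.neutral ballI coeff_eq_0 deg_h)
    then show "coeff f (card B) = coeff g (card B)"
      using degree_coeff_prod_linear[OF assms(1), of t] degree_coeff_prod_linear[OF assms(1), of 1]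
      by (simp add: f_def g_def)
    show "poly f b = poly g b" if "b \<in> B" for b
    proof -
      have "poly h b = (\<Sum>a\<in>B. (t - 1) * a * A a * (\<Prod>c\<in>B - {a}. b - c))"
        by (simp add: h_def poly_sum poly_prod)
      also have "\<dots> = (\<Sum>a\<in>{b}. (t - 1) * a * A a * (\<Prod>c\<in>B - {a}. b - c))"
        using that assms(1) by (intro sum.mono_neutral_right) auto
      also have "\<dots> = (t - 1) * b * (\<Prod>c\<in>B - {b}. (c - t * b) / (c - b) * (b - c))"
        by (simp add: A_def mult.assoc flip: prod.distrib)
      also have "(\<Prod>c\<in>B - {b}. (c - t * b) / (c - b) * (b - c)) = (\<Prod>c\<in>B - {b}. t * b - c)"
        by (rule prod.cong) (auto simp: field_simps)
      also have "(t - 1) * b * \<dots> = (\<Prod>c\<in>B. t * b - c)"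
        using that assms(1) by (subst prod.remove[of B b]) (auto simp: algebra_simps)
      finally have "poly h b = (\<Prod>c\<in>B. t * b - c)" .
      moreover have "(\<Prod>c\<in>B. b - c) = 0"
        using that assms(1) by auto
      ultimately show ?thesis
        by (simp add: f_def g_def poly_prod mult.commute)
    qed
  qed simp
  define P where "P = (\<Prod>b\<in>B. - b)"
  have P: "P \<noteq> 0" using assms by (auto simp: P_def)
  \<comment> \<open>At 0, \<open>b\<close> times the product of the other \<open>- c\<close> is
    \<open>- P\<close>, so \<open>P\<close> divides every term; it can be cancelled because 0 is not
    in \<open>B\<close>.\<close>
  have "poly f 0 = poly g 0" using \<open>f = g\<close> by simp
  then have "P = t ^ card B * P + (\<Sum>b\<in>B. (t - 1) * b * A b * (\<Prod>c\<in>B - {b}. - c))"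
    by (simp add: f_def g_def h_def P_def poly_sum poly_prod)
  also have "(\<Sum>b\<in>B. (t - 1) * b * A b * (\<Prod>c\<in>B - {b}. - c)) = (\<Sum>b\<in>B. P * ((1 - t) * A b))"
    by (rule sum.cong) (use assms(1) in \<open>auto simp: P_def prod.remove algebra_simps\<close>)
  also have "\<dots> = P * ((1 - t) * (\<Sum>b\<in>B. A b))"
    by (simp only: sum_distrib_left)
  finally have "P * 1 = P * (t ^ card B + (1 - t) * (\<Sum>b\<in>B. A b))"
    by (simp add: algebra_simps)
  then have "1 = t ^ card B + (1 - t) * (\<Sum>b\<in>B. A b)"
    using P mult_left_cancel by blast
  then show ?thesis
    unfolding A_def[symmetric] using assms(3) by (simp add: field_simps)
qed

lemma sum_permutes_rational:
  fixes t :: "'a::field"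
  assumes "t \<noteq> 1" "inj_on x {1..n}" "0 \<notin> x ` {1..n}"
  shows "(\<Sum>w | w permutes {1..n}. \<Prod>(i, j)\<in>index_pairs n.
      (x (w i) - t * x (w j)) / (x (w i) - x (w j))) = q_fact n t"
  unfolding q_fact_def
  by (rule sum_permutes_prod_pairs[where X = "- {0}" and g = "\<lambda>c b. (c - t * b) / (c - b)"])
    (use assms in \<open>auto intro!: sum_prod_rational_weight\<close>)

text \<open>For a fixed larger index the factors depend only on the difference of the indices, and
  their product telescopes. The hypothesis keeps the cancelled denominators nonzero.\<close>

lemma prod_index_pairs_telescope:
  fixes t :: "'a::field"
  assumes "\<And>k. k > 0 \<Longrightarrow> t ^ k \<noteq> 1"
  shows "(\<Prod>(i, j)\<in>index_pairs n. (1 - t ^ (j - i + 1)) / (1 - t ^ (j - i))) = q_fact n t"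
proof (induction n)
  case 0
  then show ?case by (simp add: q_fact_def)
next
  case (Suc n)
  have "(\<Prod>i=1..n. (1 - t ^ (Suc n - i + 1)) / (1 - t ^ (Suc n - i))) =
      (\<Prod>k=1..n. (1 - t ^ Suc k) / (1 - t ^ k))"
    by (rule prod.reindex_bij_witness[where i = "\<lambda>k. Suc n - k" and j = "\<lambda>i. Suc n - i"]) auto
  also have "\<dots> = (1 - t ^ Suc n) / (1 - t)"
  proof (induction n)
    case 0
    then show ?case using assms[of 1] by simp
  next
    case (Suc n)
    then show ?case using assms[of "Suc n"] by simp
  qed
  finally show ?case
    using Suc by (simp add: prod_index_pairs_Suc q_fact_def)
qed


section \<open>Length and inversions\<close>

definition inversions :: "nat \<Rightarrow> (nat \<Rightarrow> nat) \<Rightarrow> (nat \<times> nat) set" where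
  "inversions n w = {(i, j) \<in> index_pairs n. w j < w i}"

lemma inversions_subset: "inversions n w \<subseteq> index_pairs n"
  by (auto simp: inversions_def)

lemma finite_inversions [simp]: "finite (inversions n w)"
  using inversions_subset finite_index_pairs by (rule finite_subset)

lemma inversions_id: "inversions n id = {}"
  by (auto simp: inversions_def index_pairs_def)

text \<open>With weight \<open>q\<close> on inversions and 1 elsewhere, the one-step sums are
  geometric series. Their closed form, used in \<open>q_fact\<close>, divides by
  \<open>1 - q\<close>.\<close>

lemma sum_power_inversions:
  fixes q :: "'a::field"
  assumes "q \<noteq> 1"
  shows "(\<Sum>w | w permutes {1..n}. q ^ card (inversions n w)) = q_fact n q"
proof -
  have "q ^ card (inversions n w) = (\<Prod>(i, j)\<in>index_pairs n. if w j < w i then q else 1)" for w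
  proof -
    have "q ^ card (inversions n w) = (\<Prod>(i, j)\<in>inversions n w. if w j < w i then q else 1)"
      by (simp add: inversions_def case_prod_unfold)
    also have "\<dots> = (\<Prod>(i, j)\<in>index_pairs n. if w j < w i then q else 1)"
      by (rule prod.mono_neutral_left) (auto simp: inversions_def split: if_splits)
    finally show ?thesis .
  qed
  moreover have "(\<Sum>w | w permutes {1..n}. \<Prod>(i, j)\<in>index_pairs n. if w j < w i then q else 1) =
      (\<Prod>d=1..n. \<Sum>k<d. q ^ k)"
    by (rule sum_permutes_prod_pairs[where X = UNIV and g = "\<lambda>c b. if b < c then q else 1"
        and x = "\<lambda>i. i"]) (simp_all add: sum_prod_order_weight)
  ultimately show ?thesis
    using assms by (simp add: q_fact_def sum_gp_strict)
qed

lemma simple_word_Nil: "simple_word [] = id"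
  by (simp add: simple_word_def)

lemma simple_word_Cons: "simple_word (i # is) = transpose i (Suc i) \<circ> simple_word is"
  by (simp add: simple_word_def)

lemma simple_transposition_permutes:
  "i \<in> {1..<n} \<Longrightarrow> transpose i (Suc i) permutes {1..n}"
  by (rule permutes_swap_id) auto

lemma simple_word_permutes: "set is \<subseteq> {1..<n} \<Longrightarrow> simple_word is permutes {1..n}"
proof (induction "is")
  case Nil
  show ?case unfolding simple_word_Nil by (rule permutes_id)
next
  case (Cons i "is")
  then have "set is \<subseteq> {1..<n}" and i: "i \<in> {1..<n}" by auto
  then have "simple_word is permutes {1..n}" by (intro Cons.IH)
  with i show ?case
    unfolding simple_word_Cons by (intro permutes_compose simple_transposition_permutes)
qed

text \<open>Composition with \<open>transpose i (Suc i)\<close> on the left exchanges two adjacent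
  values, which sit at the positions \<open>p < q\<close>; no other comparison of values
  changes.\<close>

lemma inversions_ascent:
  assumes w: "inj w" and p: "w p = i" "1 \<le> p" and q: "w q = Suc i" "q \<le> n" and "p < q"
  shows "inversions n (transpose i (Suc i) \<circ> w) = insert (p, q) (inversions n w)"
    and "(p, q) \<notin> inversions n w"
proof -
  have less: "transpose i (Suc i) b < transpose i (Suc i) a \<longleftrightarrow>
      (a = i \<and> b = Suc i) \<or> (b < a \<and> \<not> (b = i \<and> a = Suc i))" for a b :: nat
    by (auto simp: transpose_def)
  have wp: "w a = i \<longleftrightarrow> a = p" "w a = Suc i \<longleftrightarrow> a = q" for a
    using w p q by (auto simp: inj_def)
  show "inversions n (transpose i (Suc i) \<circ> w) = insert (p, q) (inversions n w)"
    using assms by (auto simp: inversions_def index_pairs_def less wp)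
  show "(p, q) \<notin> inversions n w"
    using p q by (simp add: inversions_def)
qed

lemma card_inversions_ascent:
  assumes w: "w permutes {1..n}" and i: "i \<in> {1..<n}" and less: "inv w i < inv w (Suc i)"
  shows "card (inversions n (transpose i (Suc i) \<circ> w)) = Suc (card (inversions n w))"
proof -
  have "inv w i \<in> {1..n}" "inv w (Suc i) \<in> {1..n}"
    using i permutes_in_image[OF permutes_inv[OF w]] by auto
  then show ?thesis
    using inversions_ascent[of w "inv w i" i "inv w (Suc i)" n] less permutes_inverses[OF w]
      permutes_inj[OF w] by simp
qed

text \<open>The transposition is an involution and turns the descent into an ascent, so the ascent
  case applies to the composed permutation.\<close>

lemma card_inversions_descent:
  assumes w: "w permutes {1..n}" and i: "i \<in> {1..<n}" and less: "inv w (Suc i) < inv w i"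
  shows "card (inversions n w) = Suc (card (inversions n (transpose i (Suc i) \<circ> w)))"
proof -
  let ?s = "transpose i (Suc i)"
  have s: "?s permutes {1..n}" using i by (rule simple_transposition_permutes)
  have "inv (?s \<circ> w) = inv w \<circ> ?s"
    using permutes_inv_o(1)[OF w] by (simp add: o_inv_distrib permutes_bij[OF w])
  then have "inv (?s \<circ> w) i < inv (?s \<circ> w) (Suc i)"
    using less by simp
  from card_inversions_ascent[OF permutes_compose[OF w s] i this]
  show ?thesis by (simp add: o_assoc)
qed

lemma inv_simple_neq: "w permutes S \<Longrightarrow> inv w i \<noteq> inv w (Suc i)"
  by (metis permutes_inverses(1) n_not_Suc_n)

text \<open>Lower bound for the length: each letter changes the number of inversions by exactly one,
  up or down.\<close>

lemma card_inversions_simple_word: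
  "set is \<subseteq> {1..<n} \<Longrightarrow> card (inversions n (simple_word is)) \<le> length is"
proof (induction "is")
  case Nil
  show ?case by (simp only: simple_word_Nil inversions_id card.empty)
next
  case (Cons i "is")
  let ?w = "simple_word is"
  have "set is \<subseteq> {1..<n}" and i: "i \<in> {1..<n}"
    using Cons.prems by auto
  then have w: "?w permutes {1..n}" by (intro simple_word_permutes)
  have "card (inversions n (transpose i (Suc i) \<circ> ?w)) \<le> Suc (card (inversions n ?w))"
    using card_inversions_ascent[OF w i] card_inversions_descent[OF w i] inv_simple_neq[OF w, of i]
    by linarith
  also have "\<dots> \<le> Suc (length is)"
    using Cons.IH \<open>set is \<subseteq> {1..<n}\<close> by (simp only: Suc_le_mono)
  finally show ?case
    by (simp only: simple_word_Cons length_Cons)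
qed

text \<open>Strict growth from \<open>v 1 \<ge> 1\<close> gives \<open>i \<le> v i\<close>
  throughout, which forces a permutation of \<open>{1..n}\<close> to be the identity.\<close>

lemma permutes_ascending_eq_id:
  assumes v: "v permutes {1..n}" and asc: "\<And>i. i \<in> {1..<n} \<Longrightarrow> v i < v (Suc i)"
  shows "v = id"
proof -
  have "1 \<le> i \<Longrightarrow> i \<le> n \<Longrightarrow> i \<le> v i" for i
  proof (induction i rule: dec_induct)
    case base
    then show ?case using permutes_in_image[OF v, of 1] by simp
  next
    case (step i)
    then show ?case using asc[of i] by simp
  qed
  then show ?thesis
    using v by (intro permutes_natset_ge) auto
qed

text \<open>Upper bound for the length, by sorting: while \<open>inv w\<close> has a descent, a
  simple transposition on the left removes one inversion; without descents \<open>w\<close> is the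
  identity.\<close>

lemma exists_simple_word:
  "w permutes {1..n} \<Longrightarrow>
    \<exists>is. length is = card (inversions n w) \<and> set is \<subseteq> {1..<n} \<and> simple_word is = w"
proof (induction "card (inversions n w)" arbitrary: w rule: less_induct)
  case (less w)
  note w = less.prems
  show ?case
  proof (cases "\<exists>i\<in>{1..<n}. inv w (Suc i) < inv w i")
    case True
    then obtain i where i: "i \<in> {1..<n}" "inv w (Suc i) < inv w i" by blast
    let ?s = "transpose i (Suc i)"
    have c: "card (inversions n w) = Suc (card (inversions n (?s \<circ> w)))"
      by (rule card_inversions_descent[OF w i])
    have "?s \<circ> w permutes {1..n}"
      using w i by (intro permutes_compose simple_transposition_permutes)
    then obtain "is" where "length is = card (inversions n (?s \<circ> w))" "set is \<subseteq> {1..<n}"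
        "simple_word is = ?s \<circ> w"
      using less.hyps c by (metis lessI)
    then have "length (i # is) = card (inversions n w)" "set (i # is) \<subseteq> {1..<n}"
        "simple_word (i # is) = w"
      using c i by (auto simp: o_assoc simple_word_Cons)
    then show ?thesis by blast
  next
    case False
    then have "inv w i < inv w (Suc i)" if "i \<in> {1..<n}" for i
      using that inv_simple_neq[OF w, of i] by (meson linorder_neqE_nat)
    then have "inv w = id"
      using permutes_inv[OF w] by (intro permutes_ascending_eq_id)
    then have "w = id"
      using permutes_inv_inv[OF w] by simp
    then show ?thesis
      by (intro exI[of _ "[]"]) (simp only: simple_word_Nil inversions_id card.empty list.size list.set empty_subsetI)
  qed
qed

lemma perm_length_eq_card_inversions:
  assumes "w permutes {1..n}"
  shows "perm_length n w = card (inversions n w)"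
  unfolding perm_length_def
  by (rule Least_equality)
    (use exists_simple_word[OF assms] card_inversions_simple_word in auto)

text \<open>\<open>longest_perm\<close> is a choice among maximisers, so only its length is
  determined: the number of pairs bounds every length, and the reversal \<open>r\<close> attains
  it.\<close>

lemma perm_length_longest_perm: "perm_length n (longest_perm n) = card (index_pairs n)"
proof -
  define r where "r i = (if i \<in> {1..n} then Suc n - i else i)" for i
  have r: "r permutes {1..n}"
    by (rule bij_imp_permutes, rule bij_betw_byWitness[of _ r]) (auto simp: r_def)
  have "inversions n r = index_pairs n"
    by (auto simp: inversions_def index_pairs_def r_def)
  then have len_r: "perm_length n r = card (index_pairs n)"
    using perm_length_eq_card_inversions[OF r] by simp
  have bound: "perm_length n w \<le> card (index_pairs n)" if "w permutes {1..n}" for w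
    using perm_length_eq_card_inversions[OF that] card_mono[OF _ inversions_subset] by simp
  \<comment> \<open>The strict upper bound asked for here accounts for the
    \<open>Suc\<close>.\<close>
  note am = arg_max_nat_lemma[of "\<lambda>w. w permutes {1..n}" r "perm_length n"
      "Suc (card (index_pairs n))", folded longest_perm_def]
  have "longest_perm n permutes {1..n} \<and> perm_length n r \<le> perm_length n (longest_perm n)"
    using am r bound by (auto simp: less_Suc_eq_le)
  then show ?thesis
    using bound len_r by (simp add: le_antisym)
qed


section \<open>Values of rational functions\<close>

context coeff_hom
begin

text \<open>The relation under the \<open>THE\<close> of \<open>rf_subst\<close>. It includes the
  existence of a representation with nonvanishing denominator, so values can be computed by closure
  under the field operations.\<close>

definition has_value :: "(nat \<Rightarrow> 'b) \<Rightarrow> ratfun \<Rightarrow> 'b \<Rightarrow> bool" where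
  "has_value y f v \<longleftrightarrow> (\<exists>p q. f = Fract p q \<and> mpol_subst \<phi> y q \<noteq> 0 \<and>
     v = mpol_subst \<phi> y p / mpol_subst \<phi> y q)"

lemma rf_subst_eqI: "has_value y f v \<Longrightarrow> rf_subst \<phi> y f = v"
  by (auto simp: has_value_def rf_subst_Fract)

lemma mpol_subst_diff: "mpol_subst \<phi> y (p - q) = mpol_subst \<phi> y p - mpol_subst \<phi> y q"
  using mpol_subst_add[of y "p - q" q] by simp

lemma mpol_subst_one: "mpol_subst \<phi> y 1 = 1"
  using mpol_subst_single[of y 0 1] by (simp add: hom_one monom_subst_def)

lemma has_value_const: "has_value y (rf_const c) (\<phi> c)"
  unfolding has_value_def rf_const_def
  by (rule exI[of _ "Poly_Mapping.single 0 c"], rule exI[of _ 1])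
    (simp add: mpol_subst_single mpol_subst_one monom_subst_def)

lemma has_value_one: "has_value y 1 1"
  using has_value_const[of y 1] coeff_hom.hom_one[OF coeff_hom_rf_const] by (simp add: hom_one)

lemma has_value_var: "has_value y (rf_var i) (y i)"
  unfolding has_value_def rf_var_def
  by (rule exI[of _ "Poly_Mapping.single (Poly_Mapping.single i 1) 1"], rule exI[of _ 1])
    (simp add: mpol_subst_single mpol_subst_one monom_subst_def hom_one)

lemma has_value_mult:
  assumes "has_value y f u" "has_value y g v"
  shows "has_value y (f * g) (u * v)"
proof -
  obtain p q p' q' where "f = Fract p q" "mpol_subst \<phi> y q \<noteq> 0"
      "u = mpol_subst \<phi> y p / mpol_subst \<phi> y q"
      "g = Fract p' q'" "mpol_subst \<phi> y q' \<noteq> 0"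
      "v = mpol_subst \<phi> y p' / mpol_subst \<phi> y q'"
    using assms unfolding has_value_def by blast
  then show ?thesis
    unfolding has_value_def
    by (intro exI[of _ "p * p'"] exI[of _ "q * q'"]) (simp add: mpol_subst_mult)
qed

lemma has_value_diff:
  assumes "has_value y f u" "has_value y g v"
  shows "has_value y (f - g) (u - v)"
proof -
  obtain p q p' q' where *: "f = Fract p q" "mpol_subst \<phi> y q \<noteq> 0"
      "u = mpol_subst \<phi> y p / mpol_subst \<phi> y q"
      "g = Fract p' q'" "mpol_subst \<phi> y q' \<noteq> 0"
      "v = mpol_subst \<phi> y p' / mpol_subst \<phi> y q'"
    using assms unfolding has_value_def by blast
  \<comment> \<open>Subtraction of two \<open>Fract\<close> terms needs denominators that are
    nonzero as polynomials.\<close>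
  moreover have "q \<noteq> 0" "q' \<noteq> 0"
    using * by (auto simp: mpol_subst_zero)
  ultimately show ?thesis
    unfolding has_value_def
    by (intro exI[of _ "p * q' - p' * q"] exI[of _ "q * q'"])
      (simp add: mpol_subst_mult mpol_subst_diff diff_frac_eq)
qed

text \<open>A nonzero value means that the numerator does not vanish at \<open>y\<close>, so
  numerator and denominator may be exchanged.\<close>

lemma has_value_inverse:
  assumes "has_value y f v" "v \<noteq> 0"
  shows "has_value y (inverse f) (inverse v)"
proof -
  obtain p q where "f = Fract p q" "mpol_subst \<phi> y q \<noteq> 0"
      "v = mpol_subst \<phi> y p / mpol_subst \<phi> y q"
    using assms(1) unfolding has_value_def by blast
  then show ?thesis
    unfolding has_value_def using assms(2)
    by (intro exI[of _ q] exI[of _ p]) auto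
qed

lemma has_value_divide:
  "has_value y f u \<Longrightarrow> has_value y g v \<Longrightarrow> v \<noteq> 0 \<Longrightarrow> has_value y (f / g) (u / v)"
  unfolding divide_inverse by (intro has_value_mult has_value_inverse)

lemma has_value_prod:
  "(\<And>a. a \<in> A \<Longrightarrow> has_value y (f a) (v a)) \<Longrightarrow> has_value y (prod f A) (prod v A)"
  by (induction A rule: infinite_finite_induct) (auto intro: has_value_one has_value_mult)

section \<open>Compatibility of the coefficient homomorphism with the field operations\<close>

lemma hom_minus: "\<phi> (- a) = - \<phi> a"
  using hom_add[of a "- a"] hom_zero by (simp add: eq_neg_iff_add_eq_0 add.commute)

lemma hom_diff: "\<phi> (a - b) = \<phi> a - \<phi> b"
  using hom_add[of a "- b"] by (simp add: hom_minus)

lemma hom_inverse: "\<phi> (inverse a) = inverse (\<phi> a)"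
proof (cases "a = 0")
  case True
  then show ?thesis by (simp add: hom_zero)
next
  case False
  then have "\<phi> a * \<phi> (inverse a) = 1"
    using hom_mult[of a "inverse a"] by (simp add: hom_one)
  then show ?thesis by (simp add: inverse_unique)
qed

lemma hom_divide: "\<phi> (a / b) = \<phi> a / \<phi> b"
  by (simp add: divide_inverse hom_mult hom_inverse)

lemma hom_power: "\<phi> (a ^ k) = \<phi> a ^ k"
  by (induction k) (simp_all add: hom_one hom_mult)

lemma hom_prod: "\<phi> (prod f A) = (\<Prod>a\<in>A. \<phi> (f a))"
  by (induction A rule: infinite_finite_induct) (simp_all add: hom_one hom_mult)

lemma hom_q_fact: "\<phi> (q_fact n a) = q_fact n (\<phi> a)"
  by (simp add: q_fact_def hom_prod hom_divide hom_diff hom_one hom_power)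

text \<open>A homomorphism of fields has trivial kernel: if \<open>a - 1\<close> is nonzero, its
  image is invertible. This carries \<open>t_var \<noteq> 1\<close> over to rational
  functions.\<close>

lemma hom_eq_one_iff: "\<phi> a = 1 \<longleftrightarrow> a = 1"
proof
  assume "\<phi> a = 1"
  show "a = 1"
  proof (rule ccontr)
    assume "a \<noteq> 1"
    then have "\<phi> (a - 1) * \<phi> (inverse (a - 1)) = 1"
      by (simp flip: hom_mult add: hom_one)
    then show False using \<open>\<phi> a = 1\<close> by (simp add: hom_diff hom_one)
  qed
qed (simp add: hom_one)

end

section \<open>Nonvanishing and distinctness of the generators\<close>

lemma t_half_neq_0 [simp]: "t_half \<noteq> 0"
  by (simp add: t_half_def Zero_fract_def eq_fract)

text \<open>By degree, the indeterminate is not a root of unity; hence no denominator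
  \<open>1 - t_var ^ k\<close> with \<open>k > 0\<close> vanishes.\<close>

lemma t_half_power_neq_1: "k > 0 \<Longrightarrow> t_half ^ k \<noteq> 1"
proof -
  assume "k > 0"
  have "t_half ^ k = Fract ([:0, 1:] ^ k) 1"
    by (induction k) (simp_all add: t_half_def One_fract_def)
  moreover have "[:0, 1:] ^ k \<noteq> (1 :: complex poly)"
    using degree_linear_power[of "0::complex" k] \<open>k > 0\<close> by auto
  ultimately show ?thesis
    by (simp add: One_fract_def eq_fract)
qed

lemma t_var_power_neq_1: "k > 0 \<Longrightarrow> t_var ^ k \<noteq> 1"
  using t_half_power_neq_1[of "2 * k"] by (simp add: t_var_def power_mult)

lemma rf_var_neq_0: "rf_var i \<noteq> 0"
proof -
  have "Poly_Mapping.single (Poly_Mapping.single i 1) 1 \<noteq> (0 :: mpol)"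
    by (metis lookup_single_eq lookup_zero zero_neq_one)
  then show ?thesis by (simp add: rf_var_def Zero_fract_def eq_fract)
qed

lemma inj_rf_var: "inj rf_var"
proof
  fix i j assume "rf_var i = rf_var j"
  then have "Poly_Mapping.single (Poly_Mapping.single i 1) 1 =
      (Poly_Mapping.single (Poly_Mapping.single j (1::nat)) 1 :: mpol)"
    by (simp add: rf_var_def eq_fract)
  then have "Poly_Mapping.single i (1::nat) = Poly_Mapping.single j 1"
    by (metis lookup_single_eq lookup_single_not_eq zero_neq_one)
  then show "i = j"
    by (metis lookup_single_eq lookup_single_not_eq zero_neq_one)
qed

section \<open>Evaluation and symmetrisation of the c-functions\<close>

lemma ev_t0_c_Y: "ev_t0 n (c_Y n) = inverse t_half ^ card (index_pairs n) * q_fact n t_var"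
proof -
  interpret coeff_hom "\<lambda>c. c" by (rule coeff_hom_id)
  define y where "y i = t_half powi (- 2 * (int i - 1) + (int n - 1))" for i
  have y0: "y i \<noteq> 0" for i by (simp add: y_def)
  \<comment> \<open>The summand \<open>int n - 1\<close> cancels and the exponents of
    \<open>t_half\<close> differ by \<open>2 * (j - i)\<close>.\<close>
  have ratio: "y i * inverse (y j) = t_var ^ (j - i)" if "i < j" for i j
  proof -
    have "y i * inverse (y j) = t_half powi
        ((- 2 * (int i - 1) + (int n - 1)) - (- 2 * (int j - 1) + (int n - 1)))"
      unfolding y_def by (simp only: power_int_diff t_half_neq_0 divide_inverse simp_thms)
    also have "(- 2 * (int i - 1) + (int n - 1)) - (- 2 * (int j - 1) + (int n - 1)) =
        int (2 * (j - i))"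
      using that by simp
    also have "t_half powi \<dots> = t_var ^ (j - i)"
      unfolding power_int_of_nat t_var_def by (simp only: power_mult)
    finally show ?thesis .
  qed
  have "has_value y (c_Y n) (\<Prod>(i, j)\<in>index_pairs n.
      inverse t_half * ((1 - t_var ^ (j - i + 1)) / (1 - t_var ^ (j - i))))"
    unfolding c_Y_def index_pairs_def[symmetric]
  proof (rule has_value_prod, clarify)
    fix i j assume "(i, j) \<in> index_pairs n"
    then have "i < j" by (simp add: index_pairs_def)
    then have "1 - y i * inverse (y j) \<noteq> 0"
      using ratio t_var_power_neq_1[of "j - i"] by simp
    then have "has_value y ((rf_const (inverse t_half) - rf_const t_half * rf_var i * inverse (rf_var j)) /
       (1 - rf_var i * inverse (rf_var j)))
       ((inverse t_half - t_half * y i * inverse (y j)) / (1 - y i * inverse (y j)))"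
      by (intro has_value_divide has_value_diff has_value_mult has_value_inverse has_value_one
          has_value_const has_value_var y0)
    \<comment> \<open>Since \<open>t_half\<close> is \<open>inverse t_half * t_var\<close>, pulling
      out \<open>inverse t_half\<close> raises the exponent \<open>j - i\<close> by one.\<close>
    moreover have "inverse t_half - t_half * y i * inverse (y j) =
        inverse t_half * (1 - t_var ^ (j - i + 1))"
    proof -
      have "t_half * y i * inverse (y j) = t_half * t_var ^ (j - i)"
        by (simp only: mult.assoc ratio[OF \<open>i < j\<close>])
      moreover have "inverse t_half * (t_var * z) = t_half * z" for z
        by (simp add: t_var_def power2_eq_square)
      ultimately show ?thesis
        by (simp only: Suc_eq_plus1[symmetric] power_Suc right_diff_distrib mult_1_right)
    qed
    ultimately show "has_value y
       ((rf_const (inverse t_half) - rf_const t_half * rf_var i * inverse (rf_var j)) /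
       (1 - rf_var i * inverse (rf_var j)))
       (inverse t_half * ((1 - t_var ^ (j - i + 1)) / (1 - t_var ^ (j - i))))"
      using ratio[OF \<open>i < j\<close>] by simp
  qed
  then have "ev_t0 n (c_Y n) = (\<Prod>(i, j)\<in>index_pairs n.
      inverse t_half * ((1 - t_var ^ (j - i + 1)) / (1 - t_var ^ (j - i))))"
    unfolding ev_t0_def y_def[abs_def] by (rule rf_subst_eqI)
  also have "\<dots> = inverse t_half ^ card (index_pairs n) *
      (\<Prod>(i, j)\<in>index_pairs n. (1 - t_var ^ (j - i + 1)) / (1 - t_var ^ (j - i)))"
    by (simp only: case_prod_unfold prod.distrib prod_constant)
  finally show ?thesis
    by (simp only: prod_index_pairs_telescope[OF t_var_power_neq_1])
qed

text \<open>Multiplying numerator and denominator of each factor by \<open>rf_var (w i)\<close>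
  clears the inverses and, after \<open>inverse t_half\<close> is pulled out, leaves the rational
  weight. Injectivity of \<open>w\<close> keeps the denominators nonzero.\<close>

lemma perm_act_c_Xinv:
  assumes w: "w permutes {1..n}"
  shows "perm_act w (c_Xinv n) = rf_const (inverse t_half) ^ card (index_pairs n) *
    (\<Prod>(i, j)\<in>index_pairs n. (rf_var (w i) - rf_const t_var * rf_var (w j)) /
       (rf_var (w i) - rf_var (w j)))"
proof -
  interpret coeff_hom rf_const by (rule coeff_hom_rf_const)
  let ?x = "\<lambda>i. rf_var (w i)" and ?T = "rf_const t_half"
  have T: "?T \<noteq> 0" "rf_const (inverse t_half) = inverse ?T" "rf_const t_var = ?T * ?T"
  proof -
    show "rf_const (inverse t_half) = inverse ?T" by (rule hom_inverse)
    show "rf_const t_var = ?T * ?T" by (simp add: t_var_def power2_eq_square hom_mult)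
    have "?T * rf_const (inverse t_half) = 1" by (simp flip: hom_mult add: hom_one)
    then show "?T \<noteq> 0" by auto
  qed
  have "has_value ?x (c_Xinv n) (\<Prod>(i, j)\<in>index_pairs n. rf_const (inverse t_half) *
      ((?x i - rf_const t_var * ?x j) / (?x i - ?x j)))"
    unfolding c_Xinv_def index_pairs_def[symmetric]
  proof (rule has_value_prod, clarify)
    fix i j assume "(i, j) \<in> index_pairs n"
    then have "w i \<noteq> w j"
      using permutes_inj[OF w] by (auto simp: index_pairs_def inj_eq)
    then have neq: "?x i \<noteq> ?x j" using inj_rf_var by (simp add: inj_eq)
    then have "1 - inverse (?x i) * ?x j \<noteq> 0"
      using rf_var_neq_0[of "w i"] by (simp add: field_simps)
    then have "has_value ?x
       ((rf_const (inverse t_half) - rf_const t_half * inverse (rf_var i) * rf_var j) /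
       (1 - inverse (rf_var i) * rf_var j))
       ((rf_const (inverse t_half) - ?T * inverse (?x i) * ?x j) / (1 - inverse (?x i) * ?x j))"
      by (intro has_value_divide has_value_diff has_value_mult has_value_inverse has_value_one
          has_value_const has_value_var rf_var_neq_0)
    moreover have "(rf_const (inverse t_half) - ?T * inverse (?x i) * ?x j) /
        (1 - inverse (?x i) * ?x j) =
        rf_const (inverse t_half) * ((?x i - rf_const t_var * ?x j) / (?x i - ?x j))"
      using T neq rf_var_neq_0[of "w i"] by (simp add: divide_simps) (simp add: algebra_simps)
    ultimately show "has_value ?x
       ((rf_const (inverse t_half) - rf_const t_half * inverse (rf_var i) * rf_var j) /
       (1 - inverse (rf_var i) * rf_var j))
       (rf_const (inverse t_half) * ((?x i - rf_const t_var * ?x j) / (?x i - ?x j)))"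
      by simp
  qed
  then have "perm_act w (c_Xinv n) = (\<Prod>(i, j)\<in>index_pairs n. rf_const (inverse t_half) *
      ((?x i - rf_const t_var * ?x j) / (?x i - ?x j)))"
    unfolding perm_act_def by (rule rf_subst_eqI)
  then show ?thesis
    by (simp only: case_prod_unfold prod.distrib prod_constant)
qed

text \<open>The rational symmetrisation is applied inside the field of rational functions, to the
  distinct nonzero elements \<open>rf_var i\<close>. The result is constant because
  \<open>rf_const\<close> commutes with \<open>q_fact\<close>.\<close>

lemma sum_perm_act_c_Xinv:
  "(\<Sum>w | w permutes {1..n}. perm_act w (c_Xinv n)) =
    rf_const (inverse t_half ^ card (index_pairs n) * q_fact n t_var)"
proof -
  interpret coeff_hom rf_const by (rule coeff_hom_rf_const)
  have "rf_const t_var \<noteq> 1"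
    using t_var_power_neq_1[of 1] by (simp add: hom_eq_one_iff)
  then have "(\<Sum>w | w permutes {1..n}. \<Prod>(i, j)\<in>index_pairs n.
      (rf_var (w i) - rf_const t_var * rf_var (w j)) / (rf_var (w i) - rf_var (w j))) =
      q_fact n (rf_const t_var)"
    using rf_var_neq_0 inj_rf_var
    by (intro sum_permutes_rational) (auto intro: inj_on_subset simp: eq_commute[of 0])
  then show ?thesis
    by (simp add: perm_act_c_Xinv sum_distrib_left[symmetric] hom_mult hom_power hom_q_fact)
qed

theorem proposition4p5:
  fixes n :: nat
  assumes "n \<ge> 1"
  shows "(t_half powi (- int (perm_length n (longest_perm n))) * poincare_poly n t_var
            = ev_t0 n (c_Y n)
          \<and> rf_const (ev_t0 n (c_Y n)) = (\<Sum>w | w permutes {1..n}. perm_act w (c_Xinv n)))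
       \<and> poincare_poly n t_var
            = (\<Prod>(i, j) \<in> {(i, j). 1 \<le> i \<and> i < j \<and> j \<le> n}.
                 (1 - t_var ^ (j - i + 1)) / (1 - t_var ^ (j - i)))
       \<and> poincare_poly n t_var = q_fact n t_var"
proof -
  \<comment> \<open>As length counts inversions, the Poincare polynomial is the generating function
    of inversions.\<close>
  have W: "poincare_poly n t_var = q_fact n t_var"
    using t_var_power_neq_1[of 1] sum_power_inversions[of t_var n]
    by (simp add: poincare_poly_def perm_length_eq_card_inversions)
  have "t_half powi (- int (perm_length n (longest_perm n))) * poincare_poly n t_var
      = ev_t0 n (c_Y n)"
    by (simp add: W perm_length_longest_perm ev_t0_c_Y power_int_minus power_inverse)
  \<comment> \<open>The evaluation lies in the coefficient field, so it is compared with the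
    symmetrised sum through the embedding \<open>rf_const\<close>.\<close>
  moreover have "rf_const (ev_t0 n (c_Y n)) = (\<Sum>w | w permutes {1..n}. perm_act w (c_Xinv n))"
    by (simp only: ev_t0_c_Y sum_perm_act_c_Xinv)
  moreover have "poincare_poly n t_var
      = (\<Prod>(i, j) \<in> {(i, j). 1 \<le> i \<and> i < j \<and> j \<le> n}.
           (1 - t_var ^ (j - i + 1)) / (1 - t_var ^ (j - i)))"
    using W prod_index_pairs_telescope[of t_var n, OF t_var_power_neq_1]
    by (simp only: index_pairs_def)
  ultimately show ?thesis using W by simp
qed

end
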